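(* Let $F$ be a normed lattice with closed unit ball $B_F$. For $r\ge 1$, $F$ is $r$-semicontinuous if and only if the common order and uo closure of $B_F$ in $F$ is contained in $rB_F$. Moreover, the following conditions are equivalent: (i) $F$ is topologically semicontinuous; (ii) the norm topology of $F$ is semicontinuous; (iii) the common order and uo closure of $B_F$ is norm bounded; (iv) order closure preserves norm bounded sets (i.e. the order closure of every norm bounded subset of $F$ is norm bounded); (iv') uo closure preserves norm bounded sets (i.e. the uo closure of every norm bounded subset of $F$ is norm bounded).
   Context: A normed lattice is a real vector lattice with a lattice (solid) norm; norm completeness is not assumed. $P\uparrow f$ ($P\downarrow f$) means that $P$ is upward (downward) directed with supremum (infimum) $f$. A net $(f_p)$ in a vector lattice $F$ order converges to $f$ if there is $Q\subset F$ with $Q\downarrow 0$ such that for every $q\in Q$ there is $p_q$ with $|f_p-f|\le q$ whenever $p\ge p_q$. It uo converges to $f$ if $|f_p-f|\wedge e$ order converges to $0$ for every $e\in F_+$. A set is order (uo) closed if it contains all order (uo) limits of nets of its elements. The order (uo) closure of a set is the intersection of all order (uo) closed sets containing it. For solid sets, in particular for $B_F$, the order closure and the uo closure coincide. A solid norm $\|\cdot\|$ on $F$ with closed unit ball $B$ is semicontinuous if whenever $P\subset B\cap F_+$ and $f\in F$ satisfy $P\uparrow f$, then $\|f\|\le 1$. $F$ is $r$-semicontinuous if there is a semicontinuous (solid) norm $\|\cdot\|'$ on $F$ with $\|\cdot\|\le\|\cdot\|'\le r\|\cdot\|$. $F$ is topologically semicontinuous if it has an equivalent semicontinuous norm. A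 linear topology on a vector lattice is semicontinuous if it has a local base at the origin consisting of solid order closed sets. *)

theory Defs
  imports "HOL-Analysis.Analysis" "HOL-Library.Lattice_Algebras"
begin

(* In lattice_ab_group_add_abs the absolute value is sup x (- x).
   Completeness of the norm is not assumed. *)
class normed_lattice = real_normed_vector + ordered_real_vector + lattice_ab_group_add_abs +
  assumes norm_solid: "\<bar>x\<bar> \<le> \<bar>y\<bar> \<Longrightarrow> norm x \<le> norm y"

definition upto_sup :: "'a::order set \<Rightarrow> 'a \<Rightarrow> bool" where
  "upto_sup P f \<longleftrightarrow>
     P \<noteq> {} \<and> (\<forall>x\<in>P. \<forall>y\<in>P. \<exists>z\<in>P. x \<le> z \<and> y \<le> z) \<and>
     (\<forall>x\<in>P. x \<le> f) \<and> (\<forall>u. (\<forall>x\<in>P. x \<le> u) \<longrightarrow> f \<le> u)"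

definition downto_inf :: "'a::order set \<Rightarrow> 'a \<Rightarrow> bool" where
  "downto_inf P f \<longleftrightarrow>
     P \<noteq> {} \<and> (\<forall>x\<in>P. \<forall>y\<in>P. \<exists>z\<in>P. z \<le> x \<and> z \<le> y) \<and>
     (\<forall>x\<in>P. f \<le> x) \<and> (\<forall>l. (\<forall>x\<in>P. l \<le> x) \<longrightarrow> l \<le> f)"

definition directed_index :: "'i set \<Rightarrow> ('i \<Rightarrow> 'i \<Rightarrow> bool) \<Rightarrow> bool" where
  "directed_index I le \<longleftrightarrow>
     I \<noteq> {} \<and> (\<forall>i\<in>I. le i i) \<and>
     (\<forall>i\<in>I. \<forall>j\<in>I. \<forall>k\<in>I. le i j \<longrightarrow> le j k \<longrightarrow> le i k) \<and>
     (\<forall>i\<in>I. \<forall>j\<in>I. \<exists>k\<in>I. le i k \<and> le j k)"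

definition order_converges ::
  "'i set \<Rightarrow> ('i \<Rightarrow> 'i \<Rightarrow> bool) \<Rightarrow> ('i \<Rightarrow> 'a::lattice_ab_group_add_abs) \<Rightarrow> 'a \<Rightarrow> bool" where
  "order_converges I le f x \<longleftrightarrow>
     (\<exists>Q. downto_inf Q 0 \<and> (\<forall>q\<in>Q. \<exists>p0\<in>I. \<forall>p\<in>I. le p0 p \<longrightarrow> \<bar>f p - x\<bar> \<le> q))"

definition uo_converges ::
  "'i set \<Rightarrow> ('i \<Rightarrow> 'i \<Rightarrow> bool) \<Rightarrow> ('i \<Rightarrow> 'a::lattice_ab_group_add_abs) \<Rightarrow> 'a \<Rightarrow> bool" where
  "uo_converges I le f x \<longleftrightarrow>
     (\<forall>e\<ge>0. order_converges I le (\<lambda>p. inf \<bar>f p - x\<bar> e) 0)"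

(* A definition cannot quantify over index types, so closedness is stated for nets indexed by
   subsets of 'a set * 'a.  This loses nothing: by order_closedD and uo_closedD below, closed
   sets contain the limits of their nets over index sets of any type. *)
definition order_closed :: "'a::lattice_ab_group_add_abs set \<Rightarrow> bool" where
  "order_closed A \<longleftrightarrow>
     (\<forall>(I :: ('a set \<times> 'a) set) le f x.
        directed_index I le \<longrightarrow> (\<forall>i\<in>I. f i \<in> A) \<longrightarrow> order_converges I le f x \<longrightarrow> x \<in> A)"

definition uo_closed :: "'a::lattice_ab_group_add_abs set \<Rightarrow> bool" where
  "uo_closed A \<longleftrightarrow>
     (\<forall>(I :: ('a set \<times> 'a) set) le f x.
        directed_index I le \<longrightarrow> (\<forall>i\<in>I. f i \<in> A) \<longrightarrow> uo_converges I le f x \<longrightarrow> x \<in> A)"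

definition order_closure :: "'a::lattice_ab_group_add_abs set \<Rightarrow> 'a set" where
  "order_closure A = \<Inter>{C. order_closed C \<and> A \<subseteq> C}"

definition uo_closure :: "'a::lattice_ab_group_add_abs set \<Rightarrow> 'a set" where
  "uo_closure A = \<Inter>{C. uo_closed C \<and> A \<subseteq> C}"

definition solid :: "'a::lattice_ab_group_add_abs set \<Rightarrow> bool" where
  "solid A \<longleftrightarrow> (\<forall>x\<in>A. \<forall>y. \<bar>y\<bar> \<le> \<bar>x\<bar> \<longrightarrow> y \<in> A)"

definition solid_norm :: "('a::{ordered_real_vector,lattice_ab_group_add_abs} \<Rightarrow> real) \<Rightarrow> bool" where
  "solid_norm N \<longleftrightarrow>
     (\<forall>x. N x \<ge> 0) \<and> (\<forall>x. N x = 0 \<longleftrightarrow> x = 0) \<and>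
     (\<forall>c x. N (c *\<^sub>R x) = \<bar>c\<bar> * N x) \<and> (\<forall>x y. N (x + y) \<le> N x + N y) \<and>
     (\<forall>x y. \<bar>x\<bar> \<le> \<bar>y\<bar> \<longrightarrow> N x \<le> N y)"

definition semicontinuous_norm ::
  "('a::{ordered_real_vector,lattice_ab_group_add_abs} \<Rightarrow> real) \<Rightarrow> bool" where
  "semicontinuous_norm N \<longleftrightarrow>
     solid_norm N \<and> (\<forall>P f. P \<subseteq> {x. N x \<le> 1 \<and> 0 \<le> x} \<longrightarrow> upto_sup P f \<longrightarrow> N f \<le> 1)"

definition r_semicontinuous :: "'a::normed_lattice itself \<Rightarrow> real \<Rightarrow> bool" where
  "r_semicontinuous _ r \<longleftrightarrow>
     (\<exists>N :: 'a \<Rightarrow> real. semicontinuous_norm N \<and> (\<forall>x. norm x \<le> N x \<and> N x \<le> r * norm x))"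

definition topologically_semicontinuous :: "'a::normed_lattice itself \<Rightarrow> bool" where
  "topologically_semicontinuous _ \<longleftrightarrow>
     (\<exists>N :: 'a \<Rightarrow> real. semicontinuous_norm N \<and>
        (\<exists>c>0. \<exists>C>0. \<forall>x. c * norm x \<le> N x \<and> N x \<le> C * norm x))"

(* Meant for linear topologies T.  Members of the local base are neighbourhoods of 0, not
   necessarily open sets. *)
definition semicontinuous_topology :: "'a::lattice_ab_group_add_abs topology \<Rightarrow> bool" where
  "semicontinuous_topology T \<longleftrightarrow>
     (\<exists>\<B>. (\<forall>V\<in>\<B>. solid V \<and> order_closed V \<and> (\<exists>U. openin T U \<and> 0 \<in> U \<and> U \<subseteq> V)) \<and>
          (\<forall>U. openin T U \<and> 0 \<in> U \<longrightarrow> (\<exists>V\<in>\<B>. V \<subseteq> U)))"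

(* Reindexing of a net by pairs (tail, element of that tail). *)
definition tail_index :: "'i set \<Rightarrow> ('i \<Rightarrow> 'i \<Rightarrow> bool) \<Rightarrow> ('i \<Rightarrow> 'a) \<Rightarrow> ('a set \<times> 'a) set" where
  "tail_index I le f = {(S, y). y \<in> S \<and> (\<exists>p0\<in>I. S = f ` {p\<in>I. le p0 p})}"

definition tail_le :: "'a set \<times> 'a \<Rightarrow> 'a set \<times> 'a \<Rightarrow> bool" where
  "tail_le a b \<longleftrightarrow> fst b \<subseteq> fst a"

lemma directed_tail_index:
  assumes "directed_index I le"
  shows "directed_index (tail_index I le f) tail_le"
proof -
  have refl: "le i i" if "i \<in> I" for i
    using assms that by (auto simp: directed_index_def)
  have trans: "le i k" if "i \<in> I" "j \<in> I" "k \<in> I" "le i j" "le j k" for i j k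
    using assms that unfolding directed_index_def by blast
  have mem: "(f ` {p\<in>I. le p0 p}, f p0) \<in> tail_index I le f" if "p0 \<in> I" for p0
    using that refl by (auto simp: tail_index_def)
  obtain i0 where "i0 \<in> I" using assms by (auto simp: directed_index_def)
  then have ne: "tail_index I le f \<noteq> {}" using mem by blast
  have "\<exists>c\<in>tail_index I le f. tail_le a c \<and> tail_le b c"
    if a: "a \<in> tail_index I le f" and b: "b \<in> tail_index I le f" for a b
  proof -
    from a obtain p where p: "p \<in> I" "fst a = f ` {i\<in>I. le p i}" by (auto simp: tail_index_def)
    from b obtain q where q: "q \<in> I" "fst b = f ` {i\<in>I. le q i}" by (auto simp: tail_index_def)
    obtain k where k: "k \<in> I" "le p k" "le q k"
      using assms p q unfolding directed_index_def by blast
    have "{i\<in>I. le k i} \<subseteq> {i\<in>I. le p i}" "{i\<in>I. le k i} \<subseteq> {i\<in>I. le q i}"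
      using trans[OF p(1) k(1) _ k(2)] trans[OF q(1) k(1) _ k(3)] by auto
    then have "f ` {i\<in>I. le k i} \<subseteq> fst a" "f ` {i\<in>I. le k i} \<subseteq> fst b"
      unfolding p(2) q(2) by (simp_all add: image_mono)
    then show ?thesis using mem[OF k(1)] by (intro bexI[OF _ mem[OF k(1)]]) (simp add: tail_le_def)
  qed
  with ne show ?thesis
    unfolding directed_index_def by (auto simp: tail_le_def)
qed

lemma order_converges_tail_index:
  assumes "directed_index I le" and conv: "order_converges I le (\<lambda>p. g (f p)) x"
  shows "order_converges (tail_index I le f) tail_le (\<lambda>a. g (snd a)) x"
proof -
  obtain Q where Q: "downto_inf Q 0"
    and lim: "\<forall>q\<in>Q. \<exists>p0\<in>I. \<forall>p\<in>I. le p0 p \<longrightarrow> \<bar>g (f p) - x\<bar> \<le> q"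
    using conv unfolding order_converges_def by (elim exE conjE)
  have "\<exists>a\<in>tail_index I le f. \<forall>b\<in>tail_index I le f. tail_le a b \<longrightarrow> \<bar>g (snd b) - x\<bar> \<le> q"
    if "q \<in> Q" for q
  proof -
    obtain p0 where p0: "p0 \<in> I" "\<And>p. p \<in> I \<Longrightarrow> le p0 p \<Longrightarrow> \<bar>g (f p) - x\<bar> \<le> q"
      using bspec[OF lim \<open>q \<in> Q\<close>] by blast
    let ?a = "(f ` {p\<in>I. le p0 p}, f p0)"
    have "\<forall>i\<in>I. le i i" using assms(1) unfolding directed_index_def by (elim conjE)
    then have "?a \<in> tail_index I le f"
      using p0(1) by (auto simp: tail_index_def)
    moreover have "\<bar>g (snd b) - x\<bar> \<le> q" if "b \<in> tail_index I le f" "tail_le ?a b" for b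
    proof -
      have "snd b \<in> f ` {p\<in>I. le p0 p}"
        using that by (auto simp: tail_index_def tail_le_def)
      then show ?thesis by (auto intro: p0(2))
    qed
    ultimately show ?thesis by (intro bexI[of _ ?a] ballI impI)
  qed
  with Q show ?thesis unfolding order_converges_def by (intro exI[of _ Q] conjI ballI)
qed

lemma tail_index_mem:
  assumes "\<forall>i\<in>I. f i \<in> A"
  shows "\<forall>a\<in>tail_index I le f. snd a \<in> A"
  using assms by (auto simp: tail_index_def)

lemma order_closedD:
  fixes I :: "'i set" and f :: "'i \<Rightarrow> 'a::lattice_ab_group_add_abs"
  assumes A: "order_closed A"
    and I: "directed_index I le" "\<forall>i\<in>I. f i \<in> A" "order_converges I le f x"
  shows "x \<in> A"
proof -
  have "order_converges (tail_index I le f) tail_le snd x"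
    using order_converges_tail_index[of I le "\<lambda>y. y" f x] I by simp
  then show ?thesis
    by (rule A[unfolded order_closed_def, rule_format, rotated 2])
      (use directed_tail_index[OF I(1)] tail_index_mem[OF I(2)] in auto)
qed

lemma uo_closedD:
  fixes I :: "'i set" and f :: "'i \<Rightarrow> 'a::lattice_ab_group_add_abs"
  assumes A: "uo_closed A"
    and I: "directed_index I le" "\<forall>i\<in>I. f i \<in> A" "uo_converges I le f x"
  shows "x \<in> A"
proof -
  have "uo_converges (tail_index I le f) tail_le snd x"
    unfolding uo_converges_def
  proof (intro allI impI)
    fix e :: 'a assume "0 \<le> e"
    then have "order_converges I le (\<lambda>p. inf \<bar>f p - x\<bar> e) 0"
      using I(3) by (simp add: uo_converges_def)
    then show "order_converges (tail_index I le f) tail_le (\<lambda>p. inf \<bar>snd p - x\<bar> e) 0"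
      by (rule order_converges_tail_index[OF I(1), where g = "\<lambda>y. inf \<bar>y - x\<bar> e"])
  qed
  then show ?thesis
    by (rule A[unfolded uo_closed_def, rule_format, rotated 2])
      (use directed_tail_index[OF I(1)] tail_index_mem[OF I(2)] in auto)
qed

end

theory Submission
  imports Defs
begin

text \<open>
  A solid set that contains the suprema of its upward directed subsets of positive elements is
  uo closed: if \<open>x\<close> is a uo limit of elements of the set, then the elements
  \<open>(\<bar>x\<bar> - q)\<^sup>+\<close> lie in it by solidity and increase to \<open>\<bar>x\<bar>\<close>. So the balls of a semicontinuous norm
  are uo closed, and these balls control both closures of \<open>B\<close>. Conversely, the order closure of
  \<open>B\<close> is convex, solid and order closed, hence its Minkowski gauge is a semicontinuous norm, which
  is equivalent to the original one as soon as the closure is bounded. Since order closures are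
  contained in uo closures, this covers both kinds of closure.
\<close>

section \<open>Scalar multiples in vector lattices\<close>

lemma abs_scaleR_le:
  fixes x :: "'a::{ordered_real_vector,lattice_ab_group_add_abs}"
  shows "\<bar>c *\<^sub>R x\<bar> \<le> \<bar>c\<bar> *\<^sub>R \<bar>x\<bar>"
proof (rule abs_leI)
  \<comment> \<open>With the sign of \<open>c\<close> moved into the vector, both
    \<open>c *\<^sub>R x\<close> and its negative become \<open>d *\<^sub>R y\<close> or are at most
    \<open>0\<close>-free bounds of that shape: \<open>d\<close> is the nonnegative one of
    \<open>c\<close> and \<open>- c\<close>, and \<open>y\<close> is \<open>x\<close> or
    \<open>- x\<close>, so \<open>y \<le> \<bar>x\<bar>\<close>.\<close>
  have pos: "d *\<^sub>R y \<le> d *\<^sub>R \<bar>x\<bar>" if "0 \<le> d" "y \<le> \<bar>x\<bar>" for d y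
    using that by (rule scaleR_left_mono[rotated])
  show "c *\<^sub>R x \<le> \<bar>c\<bar> *\<^sub>R \<bar>x\<bar>"
    using pos[of c x] pos[of "- c" "- x"] abs_ge_self[of x] abs_ge_minus_self[of x]
    by (cases "0 \<le> c") auto
  show "- (c *\<^sub>R x) \<le> \<bar>c\<bar> *\<^sub>R \<bar>x\<bar>"
    using pos[of c "- x"] pos[of "- c" x] abs_ge_self[of x] abs_ge_minus_self[of x]
    by (cases "0 \<le> c") auto
qed

lemma solid_scaleR:
  fixes C :: "'a::{ordered_real_vector,lattice_ab_group_add_abs} set"
  assumes "solid C" "x \<in> C" "\<bar>c\<bar> \<le> 1"
  shows "c *\<^sub>R x \<in> C"
proof -
  have "\<bar>c *\<^sub>R x\<bar> \<le> \<bar>c\<bar> *\<^sub>R \<bar>x\<bar>" by (rule abs_scaleR_le)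
  also have "\<dots> \<le> 1 *\<^sub>R \<bar>x\<bar>" using assms(3) by (intro scaleR_right_mono) auto
  finally show ?thesis using assms(1,2) by (simp add: solid_def)
qed

lemma upto_sup_scaleR:
  fixes f :: "'a::ordered_real_vector"
  assumes P: "upto_sup P f" and c: "0 < c"
  shows "upto_sup ((*\<^sub>R) c ` P) (c *\<^sub>R f)"
proof -
  have mono: "c *\<^sub>R x \<le> c *\<^sub>R y" if "x \<le> y" for x y :: 'a
    using that c by (intro scaleR_left_mono) auto
  have "c *\<^sub>R f \<le> u" if u: "\<forall>x\<in>P. c *\<^sub>R x \<le> u" for u
  proof -
    have "\<forall>x\<in>P. x \<le> u /\<^sub>R c" using u c by (simp add: pos_le_divideR_eq)
    then have "f \<le> u /\<^sub>R c" using P by (auto simp: upto_sup_def)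
    then show ?thesis using c by (simp add: pos_le_divideR_eq)
  qed
  moreover have "\<exists>z\<in>P. c *\<^sub>R x \<le> c *\<^sub>R z \<and> c *\<^sub>R y \<le> c *\<^sub>R z" if "x \<in> P" "y \<in> P" for x y
    using P that mono unfolding upto_sup_def by meson
  ultimately show ?thesis
    using P mono unfolding upto_sup_def by (auto simp del: scaleR_le_cancel_left)
qed

lemma downto_inf_scaleR:
  fixes f :: "'a::ordered_real_vector"
  assumes Q: "downto_inf Q f" and c: "0 < c"
  shows "downto_inf ((*\<^sub>R) c ` Q) (c *\<^sub>R f)"
proof -
  have mono: "c *\<^sub>R x \<le> c *\<^sub>R y" if "x \<le> y" for x y :: 'a
    using that c by (intro scaleR_left_mono) auto
  have "u \<le> c *\<^sub>R f" if u: "\<forall>x\<in>Q. u \<le> c *\<^sub>R x" for u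
  proof -
    have "\<forall>x\<in>Q. u /\<^sub>R c \<le> x" using u c by (simp add: pos_divideR_le_eq)
    then have "u /\<^sub>R c \<le> f" using Q by (auto simp: downto_inf_def)
    then show ?thesis using c by (simp add: pos_divideR_le_eq)
  qed
  moreover have "\<exists>z\<in>Q. c *\<^sub>R z \<le> c *\<^sub>R x \<and> c *\<^sub>R z \<le> c *\<^sub>R y" if "x \<in> Q" "y \<in> Q" for x y
    using Q that mono unfolding downto_inf_def by meson
  ultimately show ?thesis
    using Q mono unfolding downto_inf_def by (auto simp del: scaleR_le_cancel_left)
qed

section \<open>Order closed and uo closed sets\<close>

lemma order_converges_imp_uo_converges:
  fixes f :: "'i \<Rightarrow> 'a::lattice_ab_group_add_abs"
  assumes "order_converges I le f x"
  shows "uo_converges I le f x"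
  unfolding uo_converges_def
proof (intro allI impI)
  fix e :: 'a assume e: "0 \<le> e"
  obtain Q where Q: "downto_inf Q 0"
    and lim: "\<forall>q\<in>Q. \<exists>p0\<in>I. \<forall>p\<in>I. le p0 p \<longrightarrow> \<bar>f p - x\<bar> \<le> q"
    using assms unfolding order_converges_def by (elim exE conjE)
  have "\<bar>inf \<bar>f p - x\<bar> e - 0\<bar> \<le> q" if "\<bar>f p - x\<bar> \<le> q" for p q
    using that e by (simp add: le_infI1)
  with lim have "\<forall>q\<in>Q. \<exists>p0\<in>I. \<forall>p\<in>I. le p0 p \<longrightarrow> \<bar>inf \<bar>f p - x\<bar> e - 0\<bar> \<le> q"
    by meson
  with Q show "order_converges I le (\<lambda>p. inf \<bar>f p - x\<bar> e) 0"
    unfolding order_converges_def by (intro exI[of _ Q] conjI)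
qed

lemma uo_closed_imp_order_closed: "uo_closed A \<Longrightarrow> order_closed A"
  unfolding uo_closed_def order_closed_def by (meson order_converges_imp_uo_converges)

lemma order_closed_Inter:
  assumes "\<And>C. C \<in> \<C> \<Longrightarrow> order_closed C"
  shows "order_closed (\<Inter>\<C>)"
  using assms unfolding order_closed_def by (meson InterE InterI)

lemma order_closed_order_closure: "order_closed (order_closure A)"
  unfolding order_closure_def by (rule order_closed_Inter) auto

lemma subset_order_closure: "A \<subseteq> order_closure A"
  by (auto simp: order_closure_def)

lemma order_closure_minimal: "order_closed C \<Longrightarrow> A \<subseteq> C \<Longrightarrow> order_closure A \<subseteq> C"
  by (auto simp: order_closure_def)

lemma uo_closure_minimal: "uo_closed C \<Longrightarrow> A \<subseteq> C \<Longrightarrow> uo_closure A \<subseteq> C"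
  by (auto simp: uo_closure_def)

lemma order_closure_subset_uo_closure: "order_closure A \<subseteq> uo_closure A"
  by (auto simp: order_closure_def uo_closure_def uo_closed_imp_order_closed)

text \<open>If \<open>Q\<close> controls the convergence of a net to \<open>x\<close>, then
  \<open>c\<close> times \<open>Q\<close> still decreases to \<open>0\<close> and controls the image
  net. So lattice Lipschitz maps preserve order convergence; this is applied to affine maps and to
  truncations.\<close>

lemma order_closed_vimage_Lipschitz:
  fixes g :: "'a::{ordered_real_vector,lattice_ab_group_add_abs} \<Rightarrow> 'a"
  assumes S: "order_closed S" and c: "0 < c"
    and g: "\<And>x y. \<bar>g x - g y\<bar> \<le> c *\<^sub>R \<bar>x - y\<bar>"
  shows "order_closed (g -` S)"
  unfolding order_closed_def
proof (intro allI impI)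
  fix I :: "('a set \<times> 'a) set" and le f x
  assume I: "directed_index I le" "\<forall>i\<in>I. f i \<in> g -` S" "order_converges I le f x"
  obtain Q where Q: "downto_inf Q 0"
    and lim: "\<forall>q\<in>Q. \<exists>p0\<in>I. \<forall>p\<in>I. le p0 p \<longrightarrow> \<bar>f p - x\<bar> \<le> q"
    using I(3) unfolding order_converges_def by (elim exE conjE)
  have "\<bar>g (f p) - g x\<bar> \<le> c *\<^sub>R q" if "\<bar>f p - x\<bar> \<le> q" for p q
    using g[of "f p" x] scaleR_left_mono[OF that less_imp_le[OF c]] by (rule order_trans)
  with lim have "\<forall>q\<in>Q. \<exists>p0\<in>I. \<forall>p\<in>I. le p0 p \<longrightarrow> \<bar>g (f p) - g x\<bar> \<le> c *\<^sub>R q"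
    by meson
  with downto_inf_scaleR[OF Q c] have "order_converges I le (\<lambda>p. g (f p)) (g x)"
    unfolding order_converges_def by (intro exI[of _ "(*\<^sub>R) c ` Q"]) auto
  then show "x \<in> g -` S"
    using order_closedD[OF S I(1), of "\<lambda>p. g (f p)"] I(2) by simp
qed

lemma order_closed_vimage_affine:
  fixes S :: "'a::{ordered_real_vector,lattice_ab_group_add_abs} set"
  assumes S: "order_closed S"
  shows "order_closed ((\<lambda>x. c *\<^sub>R x + a) -` S)"
proof (rule order_closed_vimage_Lipschitz[OF S])
  \<comment> \<open>The summand \<open>1\<close> keeps the Lipschitz constant positive when
    \<open>c = 0\<close>.\<close>
  show "0 < \<bar>c\<bar> + 1" by simp
  fix x y :: 'a
  have "\<bar>c *\<^sub>R (x - y)\<bar> \<le> \<bar>c\<bar> *\<^sub>R \<bar>x - y\<bar>" by (rule abs_scaleR_le)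
  also have "\<dots> \<le> (\<bar>c\<bar> + 1) *\<^sub>R \<bar>x - y\<bar>" by (intro scaleR_right_mono) auto
  finally show "\<bar>c *\<^sub>R x + a - (c *\<^sub>R y + a)\<bar> \<le> (\<bar>c\<bar> + 1) *\<^sub>R \<bar>x - y\<bar>"
    by (simp add: scaleR_diff_right)
qed

text \<open>Indexed by itself, \<open>P\<close> is an increasing net; the differences
  \<open>f - p\<close> decrease to \<open>0\<close> and witness its order convergence to
  \<open>f\<close>.\<close>

lemma order_closed_sup:
  fixes f :: "'a::lattice_ab_group_add_abs"
  assumes C: "order_closed C" and P: "upto_sup P f" "P \<subseteq> C"
  shows "f \<in> C"
proof -
  let ?Q = "(\<lambda>p. f - p) ` P"
  have "l \<le> 0" if "\<forall>q\<in>?Q. l \<le> q" for l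
  proof -
    have "\<forall>p\<in>P. p \<le> f - l" using that by (auto simp: algebra_simps)
    then have "f \<le> f - l" using P(1) by (auto simp: upto_sup_def)
    then show ?thesis by simp
  qed
  then have "downto_inf ?Q 0"
    using P(1) unfolding upto_sup_def downto_inf_def by simp
  moreover have "\<bar>p - f\<bar> \<le> f - q" if "q \<in> P" "p \<in> P" "q \<le> p" for p q
    using that P(1) by (subst abs_minus_commute) (auto simp: upto_sup_def)
  ultimately have "order_converges P (\<le>) (\<lambda>p. p) f"
    unfolding order_converges_def by (intro exI[of _ ?Q]) auto
  moreover have "directed_index P (\<le>)"
    using P(1) unfolding upto_sup_def directed_index_def by auto
  ultimately show ?thesis
    using order_closedD[OF C, of P "(\<le>)" "\<lambda>p. p" f] P(2) by auto
qed

lemma solid_sup_closed_imp_uo_closed: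
  fixes C :: "'a::lattice_ab_group_add_abs set"
  assumes C: "solid C" and sup: "\<And>P f. P \<subseteq> C \<Longrightarrow> \<forall>x\<in>P. 0 \<le> x \<Longrightarrow> upto_sup P f \<Longrightarrow> f \<in> C"
  shows "uo_closed C"
  unfolding uo_closed_def
proof (intro allI impI)
  fix I :: "('a set \<times> 'a) set" and le f x
  assume I: "directed_index I le" "\<forall>i\<in>I. f i \<in> C" "uo_converges I le f x"
  \<comment> \<open>Testing against the single element \<open>e = \<bar>x\<bar>\<close> suffices:
    \<open>\<bar>x\<bar> - \<bar>f p\<bar>\<close> is below both \<open>\<bar>f p - x\<bar>\<close>
    and \<open>\<bar>x\<bar>\<close>, so it survives the truncation.\<close>
  have "order_converges I le (\<lambda>p. inf \<bar>f p - x\<bar> \<bar>x\<bar>) 0"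
    using I(3) by (simp add: uo_converges_def)
  then obtain Q where Q: "downto_inf Q 0"
    and lim: "\<forall>q\<in>Q. \<exists>p0\<in>I. \<forall>p\<in>I. le p0 p \<longrightarrow> \<bar>inf \<bar>f p - x\<bar> \<bar>x\<bar> - 0\<bar> \<le> q"
    unfolding order_converges_def by (elim exE conjE)
  have refl: "\<forall>i\<in>I. le i i" using I(1) unfolding directed_index_def by (elim conjE)
  \<comment> \<open>This is the positive part of \<open>\<bar>x\<bar> - q\<close>, because
    \<open>\<bar>x\<bar> - inf q \<bar>x\<bar> = sup (\<bar>x\<bar> - q) 0\<close>.\<close>
  let ?g = "\<lambda>q. \<bar>x\<bar> - inf q \<bar>x\<bar>"
  have g_nonneg: "0 \<le> ?g q" for q by (simp only: diff_ge_0_iff_ge inf_le2)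
  have g_mono: "?g q \<le> ?g q'" if "q' \<le> q" for q q'
    using that by (intro diff_left_mono inf_mono) auto
  have "?g q \<in> C" if "q \<in> Q" for q
  proof -
    obtain p where p: "p \<in> I" "\<bar>inf \<bar>f p - x\<bar> \<bar>x\<bar> - 0\<bar> \<le> q"
      using lim refl \<open>q \<in> Q\<close> by meson
    have "\<bar>x\<bar> - \<bar>f p\<bar> \<le> \<bar>f p - x\<bar>"
      using abs_triangle_ineq2[of x "f p"] by (simp add: abs_minus_commute)
    then have "\<bar>x\<bar> - \<bar>f p\<bar> \<le> inf \<bar>f p - x\<bar> \<bar>x\<bar>" by simp
    also have "\<dots> \<le> q" using abs_ge_self[of "inf \<bar>f p - x\<bar> \<bar>x\<bar>"] p(2) by simp
    finally have "\<bar>x\<bar> - \<bar>f p\<bar> \<le> inf q \<bar>x\<bar>" by simp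
    then have "?g q \<le> \<bar>f p\<bar>" by (simp only: diff_le_eq add.commute)
    then have "\<bar>?g q\<bar> \<le> \<bar>f p\<bar>" using g_nonneg[of q] by (simp only: abs_of_nonneg)
    then show ?thesis using C I(2) p(1) by (auto simp: solid_def)
  qed
  moreover have "upto_sup (?g ` Q) \<bar>x\<bar>"
  proof -
    have "\<bar>x\<bar> \<le> u" if u: "\<forall>q\<in>Q. ?g q \<le> u" for u
    proof -
      have "\<forall>q\<in>Q. \<bar>x\<bar> - u \<le> q"
      proof
        fix q assume "q \<in> Q"
        then have "?g q \<le> u" using u by blast
        then have "\<bar>x\<bar> - u \<le> inf q \<bar>x\<bar>" by (simp only: diff_le_eq add.commute)
        then show "\<bar>x\<bar> - u \<le> q" by simp
      qed
      then have "\<bar>x\<bar> - u \<le> 0" using Q unfolding downto_inf_def by blast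
      then show ?thesis by simp
    qed
    moreover have "?g q \<le> \<bar>x\<bar>" if "q \<in> Q" for q
      using Q that by (simp add: downto_inf_def)
    moreover have "\<exists>r\<in>Q. ?g p \<le> ?g r \<and> ?g q \<le> ?g r" if "p \<in> Q" "q \<in> Q" for p q
      using Q that g_mono unfolding downto_inf_def by meson
    moreover have "Q \<noteq> {}" using Q by (simp add: downto_inf_def)
    ultimately show ?thesis unfolding upto_sup_def by simp
  qed
  ultimately have "\<bar>x\<bar> \<in> C" using g_nonneg by (intro sup[of "?g ` Q"]) auto
  then show "x \<in> C" using C by (auto simp: solid_def)
qed

section \<open>Solidity and convexity of order closures\<close>

text \<open>For fixed \<open>y\<close>, truncating \<open>y\<close> at height
  \<open>\<bar>x\<bar>\<close> is a 1-Lipschitz function of \<open>x\<close> that maps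
  \<open>A\<close> into \<open>A\<close> by solidity. The preimage of the closure is order closed
  and contains \<open>A\<close>, so the closure is mapped into itself. If
  \<open>\<bar>y\<bar> \<le> \<bar>x\<bar>\<close>, the truncation is \<open>y\<close>.\<close>

lemma solid_order_closure:
  fixes A :: "'a::{ordered_real_vector,lattice_ab_group_add_abs} set"
  assumes A: "solid A"
  shows "solid (order_closure A)"
proof -
  \<comment> \<open>\<open>y\<close> truncated to the order interval \<open>[-\<bar>x\<bar>, \<bar>x\<bar>]\<close>\<close>
  define clamp :: "'a \<Rightarrow> 'a \<Rightarrow> 'a" where "clamp y x = sup (inf y \<bar>x\<bar>) (- \<bar>x\<bar>)" for y x
  have clamp_abs: "\<bar>clamp y x\<bar> \<le> \<bar>x\<bar>" for y x
  proof (rule abs_leI)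
    have "- \<bar>x\<bar> \<le> \<bar>x\<bar>" by (rule order_trans[of _ 0]) simp_all
    then show "clamp y x \<le> \<bar>x\<bar>" by (simp add: clamp_def)
    have "- \<bar>x\<bar> \<le> clamp y x" by (simp add: clamp_def)
    then show "- clamp y x \<le> \<bar>x\<bar>" by (simp only: minus_le_iff)
  qed
  have clamp_id: "clamp y x = y" if "\<bar>y\<bar> \<le> \<bar>x\<bar>" for y x
  proof -
    have "y \<le> \<bar>x\<bar>" "- \<bar>x\<bar> \<le> y" using that by (auto simp: abs_le_iff minus_le_iff)
    then show ?thesis by (simp add: clamp_def inf_absorb1 sup_absorb1)
  qed
  \<comment> \<open>One half of the Lipschitz estimate; exchanging \<open>x\<close> and
    \<open>z\<close> gives the other. Both truncation bounds move by at most
    \<open>\<bar>x - z\<bar>\<close>, and addition distributes over \<open>inf\<close> and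
    \<open>sup\<close>.\<close>
  have clamp_le: "clamp y x \<le> clamp y z + \<bar>x - z\<bar>" for y x z
  proof -
    have d: "\<bar>x\<bar> \<le> \<bar>z\<bar> + \<bar>x - z\<bar>" "\<bar>z\<bar> \<le> \<bar>x\<bar> + \<bar>x - z\<bar>"
      using abs_triangle_ineq2[of x z] abs_triangle_ineq2[of z x]
      by (simp_all add: algebra_simps abs_minus_commute)
    have "inf y \<bar>x\<bar> \<le> inf (y + \<bar>x - z\<bar>) (\<bar>z\<bar> + \<bar>x - z\<bar>)"
      by (rule inf_mono) (use d in auto)
    then have "inf y \<bar>x\<bar> \<le> inf y \<bar>z\<bar> + \<bar>x - z\<bar>" by (simp only: add_inf_distrib_right)
    moreover have "- \<bar>x\<bar> \<le> - \<bar>z\<bar> + \<bar>x - z\<bar>" using d by (simp add: algebra_simps)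
    ultimately show ?thesis
      unfolding clamp_def add_sup_distrib_right by (rule sup_mono)
  qed
  have "\<bar>clamp y x - clamp y z\<bar> \<le> 1 *\<^sub>R \<bar>x - z\<bar>" for y x z
    using clamp_le[of y x z] clamp_le[of y z x]
    by (intro abs_leI) (simp_all add: algebra_simps abs_minus_commute)
  then have "order_closed (clamp y -` order_closure A)" for y
    by (rule order_closed_vimage_Lipschitz[OF order_closed_order_closure zero_less_one])
  then have "order_closed (\<Inter>y. clamp y -` order_closure A)"
    by (intro order_closed_Inter) auto
  moreover have "A \<subseteq> (\<Inter>y. clamp y -` order_closure A)"
    using A clamp_abs subset_order_closure[of A] unfolding solid_def by blast
  ultimately have "order_closure A \<subseteq> (\<Inter>y. clamp y -` order_closure A)"
    by (rule order_closure_minimal)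
  then have "clamp y x \<in> order_closure A" if "x \<in> order_closure A" for x y
    using that by auto
  then show ?thesis unfolding solid_def using clamp_id by metis
qed

text \<open>The two points are moved from \<open>A\<close> to its closure one at a time: with one of
  them fixed, the combination is an affine function of the other, and preimages of order closed sets
  under affine maps are order closed.\<close>

lemma convex_order_closure:
  fixes A :: "'a::{ordered_real_vector,lattice_ab_group_add_abs} set"
  assumes A: "convex A"
  shows "convex (order_closure A)"
  unfolding convex_def
proof (intro ballI allI impI)
  fix x y and u v :: real
  assume xy: "x \<in> order_closure A" "y \<in> order_closure A" and uv: "0 \<le> u" "0 \<le> v" "u + v = 1"
  have ext: "u *\<^sub>R a + b \<in> order_closure A"
    if "\<And>a. a \<in> A \<Longrightarrow> u *\<^sub>R a + b \<in> order_closure A" "a \<in> order_closure A" for u a b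
  proof -
    have "order_closure A \<subseteq> (\<lambda>x. u *\<^sub>R x + b) -` order_closure A"
      using that(1)
      by (intro order_closure_minimal order_closed_vimage_affine order_closed_order_closure) auto
    then show ?thesis using that(2) by auto
  qed
  have "v *\<^sub>R y + u *\<^sub>R a \<in> order_closure A" if "a \<in> A" for a
  proof (rule ext[OF _ xy(2)])
    fix b assume "b \<in> A"
    then have "v *\<^sub>R b + u *\<^sub>R a \<in> A" using A that uv by (simp add: convex_def add.commute)
    then show "v *\<^sub>R b + u *\<^sub>R a \<in> order_closure A" using subset_order_closure by blast
  qed
  then show "u *\<^sub>R x + v *\<^sub>R y \<in> order_closure A"
    by (intro ext[OF _ xy(1)]) (simp add: add.commute)
qed

section \<open>The Minkowski gauge of a solid convex body\<close>

lemma norm_abs_eq: "norm \<bar>x\<bar> = norm (x::'a::normed_lattice)"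
  by (intro antisym norm_solid) simp_all

lemma solid_cball: "solid (cball (0::'a::normed_lattice) r)"
  unfolding solid_def by (auto intro: order_trans[OF norm_solid])

definition minkowski_gauge :: "'a::real_vector set \<Rightarrow> 'a \<Rightarrow> real" where
  "minkowski_gauge C x = Inf {t. 0 < t \<and> x /\<^sub>R t \<in> C}"

lemma minkowski_gauge_le:
  assumes "0 < t" "x /\<^sub>R t \<in> C"
  shows "minkowski_gauge C x \<le> t"
  unfolding minkowski_gauge_def using assms by (intro cInf_lower bdd_belowI[of _ 0]) auto

text \<open>The inner ball makes \<open>C\<close> absorbing, so that the gauge is an infimum over a
  nonempty set; the outer ball makes the gauge vanish only at \<open>0\<close>. The intended
  \<open>C\<close> is the order closure of the unit ball.\<close>

locale solid_convex_body =
  fixes C :: "'a::normed_lattice set" and r :: real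
  assumes convex: "convex C" and solid: "solid C"
    and cball_subset: "cball 0 1 \<subseteq> C" and subset_cball: "C \<subseteq> cball 0 r"
begin

text \<open>The infimum need not be attained, so membership is only available strictly above the
  gauge: some \<open>t < s\<close> is admissible, and solidity allows shrinking by
  \<open>t / s\<close>. The gauge estimates below therefore argue with numbers just above the
  gauge.\<close>

lemma gauge_lessD:
  assumes "minkowski_gauge C x < s"
  shows "0 < s" "x /\<^sub>R s \<in> C"
proof -
  have pos: "0 < norm x + 1" by (simp add: add_nonneg_pos)
  then have "x /\<^sub>R (norm x + 1) \<in> C"
    by (intro subsetD[OF cball_subset]) (simp add: field_simps)
  then have "norm x + 1 \<in> {t. 0 < t \<and> x /\<^sub>R t \<in> C}" using pos by simp
  then obtain t where t: "0 < t" "x /\<^sub>R t \<in> C" "t < s"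
    using cInf_lessD[of "{t. 0 < t \<and> x /\<^sub>R t \<in> C}" s] assms
    unfolding minkowski_gauge_def by blast
  then show "0 < s" by simp
  have "(t / s) *\<^sub>R (x /\<^sub>R t) \<in> C"
    using t by (intro solid_scaleR[OF solid t(2)]) auto
  then show "x /\<^sub>R s \<in> C" using t by (simp add: field_simps)
qed

lemma gauge_nonneg: "0 \<le> minkowski_gauge C x"
  using gauge_lessD(1)[of x] by (meson linorder_not_le order_less_irrefl)

lemma gauge_le_norm: "minkowski_gauge C x \<le> norm x"
proof (rule dense_ge)
  fix t assume t: "norm x < t"
  then have "0 < t" using norm_ge_zero[of x] by linarith
  moreover have "x /\<^sub>R t \<in> C"
    using t \<open>0 < t\<close> by (intro subsetD[OF cball_subset]) (simp add: field_simps)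
  ultimately show "minkowski_gauge C x \<le> t" by (rule minkowski_gauge_le)
qed

lemma norm_le_gauge: "norm x \<le> r * minkowski_gauge C x"
proof -
  have "0 \<in> C" using cball_subset by auto
  then have r: "0 \<le> r" using subset_cball by auto
  have *: "norm x \<le> r * t" if "minkowski_gauge C x < t" for t
  proof -
    have "x /\<^sub>R t \<in> cball 0 r" using gauge_lessD(2)[OF that] subset_cball by blast
    then show ?thesis using gauge_lessD(1)[OF that] by (simp add: field_simps)
  qed
  show ?thesis
  proof (rule field_le_epsilon)
    fix e :: real assume e: "0 < e"
    \<comment> \<open>The denominator \<open>r + 1\<close> is positive even if \<open>r = 0\<close>,
      and \<open>r * ?d \<le> e\<close>.\<close>
    let ?d = "e / (r + 1)"
    have "norm x \<le> r * (minkowski_gauge C x + ?d)" using e r by (intro *) simp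
    also have "\<dots> = r * minkowski_gauge C x + r * ?d" by (simp add: distrib_left)
    also have "r * ?d \<le> e" using e r by (simp add: field_simps)
    finally show "norm x \<le> r * minkowski_gauge C x + e" by simp
  qed
qed

lemma gauge_mono:
  assumes "\<bar>x\<bar> \<le> \<bar>y\<bar>"
  shows "minkowski_gauge C x \<le> minkowski_gauge C y"
proof (rule dense_ge)
  fix t assume t: "minkowski_gauge C y < t"
  note y = gauge_lessD[OF t]
  have x: "\<bar>x /\<^sub>R t\<bar> \<le> \<bar>x\<bar> /\<^sub>R t" using abs_scaleR_le[of "inverse t" x] y(1) by simp
  \<comment> \<open>\<open>abs_scaleR_le\<close> bounds the modulus of a multiple from above only;
    applied to \<open>y\<close> as a multiple of \<open>y /\<^sub>R t\<close>, it yields the lower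
    bound for \<open>\<bar>y /\<^sub>R t\<bar>\<close>.\<close>
  have "\<bar>y\<bar> = \<bar>t *\<^sub>R (y /\<^sub>R t)\<bar>" using y(1) by simp
  also have "\<dots> \<le> \<bar>t\<bar> *\<^sub>R \<bar>y /\<^sub>R t\<bar>" by (rule abs_scaleR_le)
  finally have "\<bar>x\<bar> \<le> t *\<^sub>R \<bar>y /\<^sub>R t\<bar>" using assms y(1) by simp
  then have "\<bar>x\<bar> /\<^sub>R t \<le> \<bar>y /\<^sub>R t\<bar>" using y(1) by (simp add: pos_divideR_le_eq)
  with x have "\<bar>x /\<^sub>R t\<bar> \<le> \<bar>y /\<^sub>R t\<bar>" by (rule order_trans)
  then have "x /\<^sub>R t \<in> C" using solid y(2) by (auto simp: solid_def)
  with y(1) show "minkowski_gauge C x \<le> t" by (rule minkowski_gauge_le)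
qed

lemma gauge_triangle: "minkowski_gauge C (x + y) \<le> minkowski_gauge C x + minkowski_gauge C y"
proof (rule field_le_epsilon)
  fix e :: real assume e: "0 < e"
  define s t where "s = minkowski_gauge C x + e / 2" and "t = minkowski_gauge C y + e / 2"
  have s: "0 < s" "x /\<^sub>R s \<in> C" and t: "0 < t" "y /\<^sub>R t \<in> C"
    using gauge_lessD[of x s] gauge_lessD[of y t] e by (auto simp: s_def t_def)
  \<comment> \<open>The weights are chosen so that this convex combination equals
    \<open>(x + y) /\<^sub>R (s + t)\<close>.\<close>
  have "(s / (s + t)) *\<^sub>R (x /\<^sub>R s) + (t / (s + t)) *\<^sub>R (y /\<^sub>R t) \<in> C"
    using s t by (intro convexD[OF convex]) (auto simp: add_divide_distrib[symmetric])
  also have "(s / (s + t)) *\<^sub>R (x /\<^sub>R s) + (t / (s + t)) *\<^sub>R (y /\<^sub>R t) = (x + y) /\<^sub>R (s + t)"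
  proof -
    have "s / (s + t) * inverse s = inverse (s + t)" "t / (s + t) * inverse t = inverse (s + t)"
      using s t by (simp_all add: field_simps)
    then show ?thesis by (simp only: scaleR_scaleR scaleR_add_right)
  qed
  finally have "minkowski_gauge C (x + y) \<le> s + t"
    using s t by (intro minkowski_gauge_le) auto
  then show "minkowski_gauge C (x + y) \<le> minkowski_gauge C x + minkowski_gauge C y + e"
    by (simp add: s_def t_def)
qed

lemma gauge_zero_iff: "minkowski_gauge C x = 0 \<longleftrightarrow> x = 0"
  using gauge_nonneg[of x] gauge_le_norm[of x] norm_le_gauge[of x] by auto

lemma gauge_scaleR: "minkowski_gauge C (c *\<^sub>R x) = \<bar>c\<bar> * minkowski_gauge C x"
proof (cases "c = 0")
  case True
  then show ?thesis using gauge_zero_iff[of 0] by simp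
next
  case False
  \<comment> \<open>One inequality for all nonzero scalars is enough: the reverse one for
    \<open>c\<close> comes from \<open>inverse c\<close> acting on
    \<open>c *\<^sub>R x\<close>.\<close>
  have le: "minkowski_gauge C (d *\<^sub>R y) \<le> \<bar>d\<bar> * minkowski_gauge C y" if d: "d \<noteq> 0" for d y
  proof -
    have "minkowski_gauge C (d *\<^sub>R y) / \<bar>d\<bar> \<le> minkowski_gauge C y"
    proof (rule dense_ge)
      fix t assume t: "minkowski_gauge C y < t"
      have "sgn d *\<^sub>R (y /\<^sub>R t) \<in> C"
        using gauge_lessD(2)[OF t] by (rule solid_scaleR[OF solid]) (simp add: abs_sgn_eq)
      also have "sgn d *\<^sub>R (y /\<^sub>R t) = (d *\<^sub>R y) /\<^sub>R (\<bar>d\<bar> * t)"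
        using d by (simp add: sgn_div_norm divide_inverse mult_ac)
      finally have "minkowski_gauge C (d *\<^sub>R y) \<le> \<bar>d\<bar> * t"
        using d gauge_lessD(1)[OF t] by (intro minkowski_gauge_le) auto
      then show "minkowski_gauge C (d *\<^sub>R y) / \<bar>d\<bar> \<le> t" using d by (simp add: field_simps)
    qed
    then show ?thesis using d by (simp add: field_simps)
  qed
  have "minkowski_gauge C x \<le> minkowski_gauge C (c *\<^sub>R x) / \<bar>c\<bar>"
    using le[of "inverse c" "c *\<^sub>R x"] False by (simp add: divide_inverse mult.commute)
  then show ?thesis using le[of c x] False by (simp add: field_simps)
qed

lemma solid_norm_gauge: "solid_norm (minkowski_gauge C)"
  unfolding solid_norm_def
  using gauge_nonneg gauge_zero_iff gauge_scaleR gauge_triangle gauge_mono by blast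

text \<open>An element of gauge at most \<open>1\<close> lies in \<open>C\<close> after division by
  any \<open>t > 1\<close>. Order closedness puts the supremum, divided by \<open>t\<close>, into
  \<open>C\<close>; then \<open>t\<close> tends to \<open>1\<close>.\<close>

lemma semicontinuous_norm_gauge:
  assumes C: "order_closed C"
  shows "semicontinuous_norm (minkowski_gauge C)"
  unfolding semicontinuous_norm_def
proof (intro conjI solid_norm_gauge allI impI)
  fix P f assume P: "P \<subseteq> {x. minkowski_gauge C x \<le> 1 \<and> 0 \<le> x}" "upto_sup P f"
  show "minkowski_gauge C f \<le> 1"
  proof (rule dense_ge)
    fix t :: real assume t: "1 < t"
    have "x /\<^sub>R t \<in> C" if "x \<in> P" for x
      using P(1) that t by (intro gauge_lessD(2)) auto
    then have "f /\<^sub>R t \<in> C"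
      using t by (intro order_closed_sup[OF C upto_sup_scaleR[OF P(2)]]) auto
    then show "minkowski_gauge C f \<le> t" using t by (intro minkowski_gauge_le) auto
  qed
qed

end

section \<open>Balls of a semicontinuous norm\<close>

lemma solid_norm_mult:
  assumes "solid_norm N" "0 < c"
  shows "solid_norm (\<lambda>x. c * N x)"
  using assms unfolding solid_norm_def
  by (auto simp: mult_left_mono distrib_left[symmetric])

lemma semicontinuous_norm_mult:
  assumes N: "semicontinuous_norm N" and c: "0 < c"
  shows "semicontinuous_norm (\<lambda>x. c * N x)"
  unfolding semicontinuous_norm_def
proof (intro conjI allI impI)
  have sN: "solid_norm N" using N by (simp add: semicontinuous_norm_def)
  then show "solid_norm (\<lambda>x. c * N x)" using c by (rule solid_norm_mult)
  have scale: "N (c *\<^sub>R x) = c * N x" for x using sN c by (simp add: solid_norm_def)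
  fix P f assume P: "P \<subseteq> {x. c * N x \<le> 1 \<and> 0 \<le> x}" "upto_sup P f"
  have "(*\<^sub>R) c ` P \<subseteq> {x. N x \<le> 1 \<and> 0 \<le> x}"
    using P(1) c by (auto simp: scale scaleR_nonneg_nonneg)
  then have "N (c *\<^sub>R f) \<le> 1"
    by (rule N[unfolded semicontinuous_norm_def, THEN conjunct2, rule_format])
      (rule upto_sup_scaleR[OF P(2) c])
  then show "c * N f \<le> 1" by (simp add: scale)
qed

text \<open>The ball of radius \<open>s\<close> is the unit ball of the rescaled norm
  \<open>inverse s * N\<close>, which is again semicontinuous; this gives the closure under suprema
  needed for uo closedness.\<close>

lemma semicontinuous_norm_sublevel:
  assumes N: "semicontinuous_norm N" and s: "0 < s"
  shows "solid {x. N x \<le> s}" "uo_closed {x. N x \<le> s}"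
proof -
  have eq: "{x. N x \<le> s} = {x. inverse s * N x \<le> 1}" using s by (simp add: field_simps)
  have N': "semicontinuous_norm (\<lambda>x. inverse s * N x)"
    using N s by (intro semicontinuous_norm_mult) auto
  have mono: "N y \<le> N x" if "\<bar>y\<bar> \<le> \<bar>x\<bar>" for x y
    using N that by (simp add: semicontinuous_norm_def solid_norm_def)
  show sol: "solid {x. N x \<le> s}"
    unfolding solid_def mem_Collect_eq using mono order_trans by blast
  show "uo_closed {x. N x \<le> s}"
  proof (rule solid_sup_closed_imp_uo_closed[OF sol])
    fix P f assume P: "P \<subseteq> {x. N x \<le> s}" "\<forall>x\<in>P. 0 \<le> x" "upto_sup P f"
    then have "P \<subseteq> {x. inverse s * N x \<le> 1 \<and> 0 \<le> x}" unfolding eq by blast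
    then have "inverse s * N f \<le> 1"
      using N'[unfolded semicontinuous_norm_def, THEN conjunct2, rule_format] P(3) by blast
    then show "f \<in> {x. N x \<le> s}" unfolding eq by simp
  qed
qed

lemma uo_closure_cball_subset:
  fixes N :: "'a::normed_lattice \<Rightarrow> real"
  assumes N: "semicontinuous_norm N" and C: "0 < C" "\<And>x. N x \<le> C * norm x" and R: "0 < R"
  shows "uo_closure (cball 0 R) \<subseteq> {x. N x \<le> C * R}"
proof (rule uo_closure_minimal)
  show "uo_closed {x. N x \<le> C * R}"
    using N C(1) R by (intro semicontinuous_norm_sublevel) auto
  show "cball 0 R \<subseteq> {x. N x \<le> C * R}"
  proof
    fix x :: 'a assume "x \<in> cball 0 R"
    then have "C * norm x \<le> C * R" using C(1) by simp
    with C(2)[of x] show "x \<in> {x. N x \<le> C * R}" by simp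
  qed
qed

section \<open>The characterizations of semicontinuity\<close>

lemma r_semicontinuous_if_order_closure:
  assumes r: "1 \<le> r" and sub: "order_closure (cball (0::'a::normed_lattice) 1) \<subseteq> cball 0 r"
  shows "r_semicontinuous TYPE('a) r"
proof -
  let ?C = "order_closure (cball (0::'a) 1)"
  interpret solid_convex_body ?C r
    by (rule solid_convex_body.intro[OF convex_order_closure[OF convex_cball]
          solid_order_closure[OF solid_cball] subset_order_closure sub])
  \<comment> \<open>The gauge is at most \<open>norm\<close>, and \<open>norm\<close> is at most
    \<open>r\<close> times the gauge. The factor \<open>r\<close> thus lifts the gauge above
    \<open>norm\<close> while keeping it below \<open>r * norm x\<close>.\<close>
  have "semicontinuous_norm (\<lambda>x. r * minkowski_gauge ?C x)"
    using r by (intro semicontinuous_norm_mult semicontinuous_norm_gauge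
      order_closed_order_closure) auto
  moreover have "r * minkowski_gauge ?C x \<le> r * norm x" for x
    using r gauge_le_norm[of x] by (intro mult_left_mono) auto
  ultimately show ?thesis
    unfolding r_semicontinuous_def using norm_le_gauge by blast
qed

lemma r_semicontinuous_imp_uo_closure:
  assumes r: "1 \<le> r" and rs: "r_semicontinuous TYPE('a::normed_lattice) r"
  shows "uo_closure (cball (0::'a) 1) \<subseteq> cball 0 r"
proof -
  obtain N :: "'a \<Rightarrow> real" where N: "semicontinuous_norm N"
    "\<And>x. norm x \<le> N x" "\<And>x. N x \<le> r * norm x"
    using rs unfolding r_semicontinuous_def by blast
  have "uo_closure (cball 0 1) \<subseteq> {x. N x \<le> r * 1}"
    using r by (intro uo_closure_cball_subset N) auto
  also have "\<dots> \<subseteq> cball 0 r"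
  proof
    fix x assume "x \<in> {x. N x \<le> r * 1}"
    with N(2)[of x] show "x \<in> cball 0 r" by simp
  qed
  finally show ?thesis .
qed

lemma topologically_semicontinuous_if_order_closure:
  assumes "bounded (order_closure (cball (0::'a::normed_lattice) 1))"
  shows "topologically_semicontinuous TYPE('a)"
proof -
  obtain b where b: "\<forall>x\<in>order_closure (cball (0::'a) 1). norm x \<le> b"
    using assms unfolding bounded_iff by blast
  \<comment> \<open>The maximum with \<open>1\<close> makes the quantitative criterion for
    \<open>1 \<le> r\<close> applicable.\<close>
  define r where "r = max 1 b"
  have r: "1 \<le> r" "b \<le> r" by (simp_all add: r_def)
  have "order_closure (cball (0::'a) 1) \<subseteq> cball 0 r"
  proof
    fix x assume "x \<in> order_closure (cball (0::'a) 1)"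
    then have "norm x \<le> r" using b r(2) order_trans by blast
    then show "x \<in> cball 0 r" by simp
  qed
  with r(1) have "r_semicontinuous TYPE('a) r" by (rule r_semicontinuous_if_order_closure)
  then obtain N :: "'a \<Rightarrow> real" where N: "semicontinuous_norm N"
    "\<forall>x. norm x \<le> N x \<and> N x \<le> r * norm x"
    unfolding r_semicontinuous_def by (elim exE conjE)
  have "\<exists>c>0. \<exists>C>0. \<forall>x. c * norm x \<le> N x \<and> N x \<le> C * norm x"
    using N(2) r(1) by (intro exI[of _ 1] exI[of _ r] conjI) simp_all
  with N(1) show ?thesis
    unfolding topologically_semicontinuous_def by (intro exI[of _ N] conjI)
qed

text \<open>A bounded set lies in an \<open>N\<close>-ball, which is uo closed and so retains the
  closure; equivalence of the norms turns the \<open>N\<close>-bound back into a norm bound.\<close>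

lemma topologically_semicontinuous_imp_uo_closure:
  fixes A :: "'a::normed_lattice set"
  assumes "topologically_semicontinuous TYPE('a)" and A: "bounded A"
  shows "bounded (uo_closure A)"
proof -
  obtain N :: "'a \<Rightarrow> real" and c C where N: "semicontinuous_norm N"
    and c: "0 < c" "\<And>x. c * norm x \<le> N x" and C: "0 < C" "\<And>x. N x \<le> C * norm x"
    using assms(1) unfolding topologically_semicontinuous_def by blast
  obtain R where R: "0 < R" "A \<subseteq> cball 0 R"
    using A by (auto simp: bounded_pos subset_iff)
  have "uo_closure A \<subseteq> uo_closure (cball 0 R)"
    using R(2) by (auto simp: uo_closure_def)
  also have "\<dots> \<subseteq> {x. N x \<le> C * R}"
    using N C R(1) by (rule uo_closure_cball_subset)
  finally have sub: "uo_closure A \<subseteq> {x. N x \<le> C * R}" .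
  have "norm x \<le> C * R / c" if "x \<in> uo_closure A" for x
  proof -
    have "c * norm x \<le> C * R" using sub that c(2)[of x] by force
    then show ?thesis using c(1) by (simp add: field_simps)
  qed
  then show ?thesis by (auto simp: bounded_iff)
qed

lemma topologically_semicontinuous_imp_semicontinuous_topology:
  assumes "topologically_semicontinuous TYPE('a::normed_lattice)"
  shows "semicontinuous_topology (euclidean :: 'a topology)"
proof -
  obtain N :: "'a \<Rightarrow> real" and c C where N: "semicontinuous_norm N"
    and c: "0 < c" "\<And>x. c * norm x \<le> N x" and C: "0 < C" "\<And>x. N x \<le> C * norm x"
    using assms unfolding topologically_semicontinuous_def by blast
  \<comment> \<open>The \<open>N\<close>-balls form the local base: \<open>?V s\<close> contains the
    norm ball of radius \<open>s / C\<close>, and \<open>?V (c * e)\<close> lies in the one of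
    radius \<open>e\<close>.\<close>
  let ?V = "\<lambda>s. {x. N x \<le> s}"
  have "\<exists>U. open U \<and> 0 \<in> U \<and> U \<subseteq> ?V s" if "0 < s" for s
  proof -
    have "ball 0 (s / C) \<subseteq> ?V s"
    proof
      fix x :: 'a assume "x \<in> ball 0 (s / C)"
      then have "C * norm x < s" using C(1) by (simp add: field_simps)
      with C(2)[of x] show "x \<in> ?V s" by simp
    qed
    then show ?thesis using that C(1) by (intro exI[of _ "ball 0 (s / C)"]) auto
  qed
  moreover have "\<exists>s>0. ?V s \<subseteq> U" if U: "open U" "0 \<in> U" for U
  proof -
    obtain e where e: "0 < e" "cball 0 e \<subseteq> U" using U by (meson open_contains_cball)
    have "?V (c * e) \<subseteq> cball 0 e"
    proof
      fix x assume "x \<in> ?V (c * e)"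
      with c(2)[of x] have "c * norm x \<le> c * e" by simp
      then show "x \<in> cball 0 e" using c(1) by simp
    qed
    then show ?thesis using e c(1) by (intro exI[of _ "c * e"]) auto
  qed
  ultimately show ?thesis
    unfolding semicontinuous_topology_def open_openin[symmetric]
    using semicontinuous_norm_sublevel[OF N]
    by (intro exI[of _ "?V ` {0<..}"])
      (auto intro: uo_closed_imp_order_closed simp: Bex_def)
qed

text \<open>An order closed neighbourhood of \<open>0\<close> inside the unit ball contains a ball
  of radius \<open>e\<close>. Dilated by \<open>1 / e\<close>, it is an order closed set that
  contains the unit ball and has norm bound \<open>1 / e\<close>.\<close>

lemma semicontinuous_topology_imp_bounded_order_closure:
  assumes "semicontinuous_topology (euclidean :: 'a::normed_lattice topology)"
  shows "bounded (order_closure (cball (0::'a) 1))"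
proof -
  have "open (ball (0::'a) 1)" "(0::'a) \<in> ball 0 1" by auto
  then obtain V U where V: "order_closed V" "V \<subseteq> ball (0::'a) 1" and U: "open U" "0 \<in> U" "U \<subseteq> V"
    using assms unfolding semicontinuous_topology_def open_openin[symmetric] by meson
  obtain e where e: "0 < e" "cball 0 e \<subseteq> U" using U by (meson open_contains_cball)
  let ?W = "(\<lambda>x. e *\<^sub>R x + 0) -` V"
  have "order_closure (cball 0 1) \<subseteq> ?W"
  proof (rule order_closure_minimal[OF order_closed_vimage_affine[OF V(1)]])
    show "cball 0 1 \<subseteq> ?W"
    proof
      fix x :: 'a assume "x \<in> cball 0 1"
      then have "e *\<^sub>R x \<in> cball 0 e" using e(1) by simp
      then have "e *\<^sub>R x \<in> V" using e(2) U(3) by blast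
      then show "x \<in> ?W" by simp
    qed
  qed
  moreover have "norm x \<le> 1 / e" if "x \<in> ?W" for x
  proof -
    have "e *\<^sub>R x \<in> ball 0 1" using that V(2) by auto
    then show ?thesis using e(1) by (simp add: field_simps)
  qed
  ultimately show ?thesis unfolding bounded_iff by blast
qed

theorem proposition3p5:
  shows "(\<forall>r\<ge>1. (r_semicontinuous TYPE('a::normed_lattice) r \<longleftrightarrow> order_closure (cball (0::'a::normed_lattice) 1) \<subseteq> (\<lambda>x. r *\<^sub>R x) ` cball 0 1)
               \<and> (r_semicontinuous TYPE('a::normed_lattice) r \<longleftrightarrow> uo_closure (cball (0::'a::normed_lattice) 1) \<subseteq> (\<lambda>x. r *\<^sub>R x) ` cball 0 1))
    \<and> (topologically_semicontinuous TYPE('a::normed_lattice) \<longleftrightarrow> semicontinuous_topology (euclidean :: 'a topology))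
    \<and> (topologically_semicontinuous TYPE('a::normed_lattice) \<longleftrightarrow> bounded (order_closure (cball (0::'a::normed_lattice) 1)))
    \<and> (topologically_semicontinuous TYPE('a::normed_lattice) \<longleftrightarrow> bounded (uo_closure (cball (0::'a::normed_lattice) 1)))
    \<and> (topologically_semicontinuous TYPE('a::normed_lattice) \<longleftrightarrow>
         (\<forall>A :: 'a set. bounded A \<longrightarrow> bounded (order_closure A)))
    \<and> (topologically_semicontinuous TYPE('a::normed_lattice) \<longleftrightarrow>
         (\<forall>A :: 'a set. bounded A \<longrightarrow> bounded (uo_closure A)))"
proof -
  let ?B = "cball (0::'a) 1"
  have img: "(\<lambda>x. r *\<^sub>R x) ` ?B = cball 0 r" if "1 \<le> r" for r
    using that by (subst cball_scale) auto
  have r: "(r_semicontinuous TYPE('a) r \<longleftrightarrow> order_closure ?B \<subseteq> (\<lambda>x. r *\<^sub>R x) ` ?B) \<and>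
    (r_semicontinuous TYPE('a) r \<longleftrightarrow> uo_closure ?B \<subseteq> (\<lambda>x. r *\<^sub>R x) ` ?B)" if "1 \<le> r" for r
    \<comment> \<open>The cycle runs from \<open>r\<close>-semicontinuity to the uo closure, on to
      the smaller order closure, and back through the gauge.\<close>
    unfolding img[OF that]
    using r_semicontinuous_imp_uo_closure[OF that] r_semicontinuous_if_order_closure[OF that]
      order_closure_subset_uo_closure[of ?B] by blast
  have uo: "bounded (order_closure A)" if "bounded (uo_closure A)" for A :: "'a set"
    using that order_closure_subset_uo_closure by (rule bounded_subset)
  \<comment> \<open>\<open>Q\<close> is topological semicontinuity, \<open>R\<close> the topology
    condition, \<open>S\<close> and \<open>T\<close> boundedness of the order and uo closure of the
    ball, \<open>U\<close> and \<open>V\<close> preservation of bounded sets by order and uo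
    closure. Every chain of implications returns to \<open>Q\<close> through
    \<open>S\<close>.\<close>
  have equiv: "Q = R \<and> Q = S \<and> Q = T \<and> Q = U \<and> Q = V"
    if "Q \<Longrightarrow> V" "V \<Longrightarrow> U" "V \<Longrightarrow> T" "U \<Longrightarrow> S" "T \<Longrightarrow> S" "S \<Longrightarrow> Q" "Q \<Longrightarrow> R" "R \<Longrightarrow> S" for Q R S T U V
    using that by blast
  show ?thesis
  proof (rule conjI, use r in blast, rule equiv)
    assume "topologically_semicontinuous TYPE('a)"
    then show "\<forall>A :: 'a set. bounded A \<longrightarrow> bounded (uo_closure A)"
      "semicontinuous_topology (euclidean :: 'a topology)"
      by (simp_all add: topologically_semicontinuous_imp_uo_closure
        topologically_semicontinuous_imp_semicontinuous_topology)
  next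
    assume "semicontinuous_topology (euclidean :: 'a topology)"
    then show "bounded (order_closure ?B)"
      by (rule semicontinuous_topology_imp_bounded_order_closure)
  next
    assume "bounded (order_closure ?B)"
    then show "topologically_semicontinuous TYPE('a)"
      by (rule topologically_semicontinuous_if_order_closure)
  qed (use uo in simp_all)
qed

end
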